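(* Let $ABC$ be a (nondegenerate) triangle in the Euclidean plane, let $r,s,t$ be independent random variables uniformly distributed on $[0,1]$, and let $R = B + r\,\overrightarrow{BC}$, $S = C + s\,\overrightarrow{CA}$, $T = A + t\,\overrightarrow{AB}$. Let $Q = |\Delta RST|/|\Delta ABC|$ and let $\mathrm{CDF}(c) = P(Q \le c)$ be its cumulative distribution function. Then $$\mathrm{CDF}(c) = \begin{cases} c-\left(3c-\frac12\right)\ln c+(1-4c)^{3/2}\tanh^{-1}\sqrt{1-4c}, & 0\le c< \frac14,\\[2pt] \frac14(1+\ln 4), & c=\frac14,\\[2pt] c-\left(3c-\frac12\right)\ln c+(4c-1)^{3/2}\left(\tan^{-1}\sqrt{4c-1}-\frac{\pi}{3}\right), & \frac14< c\le 1,\end{cases}$$ where at $c=0$ the right-hand side is understood as its limit as $c\to 0^+$.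
   Context: $|\Delta XYZ|$ denotes the signed area of the triangle $XYZ$ (sign determined by the orientation of the ordered triple of vertices). One has $Q = Q(r,s,t) = rst+(1-r)(1-s)(1-t)$, and $\mathrm{CDF}(c)$ is the volume of $\{(r,s,t)\in[0,1]^3 : Q(r,s,t)\le c\}$. $\ln$ is the natural logarithm, $\tanh^{-1}$ is the inverse hyperbolic tangent on $(-1,1)$, $\tanh^{-1}(a)=\frac12\ln\frac{1+a}{1-a}$, and $\tan^{-1}$ is the principal branch of the arctangent. *)

theory Defs
  imports "HOL-Probability.Probability"
begin

text \<open>Half the determinant of the edge vectors (rows): positive iff \<open>X, Y, Z\<close> is
  counterclockwise.\<close>

definition signed_area :: "real^2 \<Rightarrow> real^2 \<Rightarrow> real^2 \<Rightarrow> real" where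
  "signed_area X Y Z = det (vector [Y - X, Z - X] :: real^2^2) / 2"

end

theory Submission
  imports Defs
begin

text \<open>
  An affine change of coordinates turns the area ratio into the polynomial
  \<open>rst + (1 - r)(1 - s)(1 - t)\<close>. Fix \<open>r = p\<close> and put \<open>q = 1 - p\<close>. Centred at \<open>s = t = q\<close>, the
  polynomial equals \<open>(s - q)(t - q) + p q\<close>, so the ratio exceeds \<open>c\<close> exactly when the point \<open>(s, t)\<close>
  of the unit square satisfies \<open>(s - q)(t - q) > k\<close>, where \<open>k = p\<^sup>2 - p + c\<close>. The conditional
  probability of exceeding \<open>c\<close> is therefore an area cut off by a hyperbola. The hyperbola has
  one part over \<open>s > q\<close> and one over \<open>s < q\<close>, each of which is integrated by hand.

  These areas depend on the sign of \<open>k\<close> and on whether \<open>p\<close> and \<open>q\<close> exceed \<open>c\<close>, but their sum is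
  always \<open>h(p) + h(q)\<close>, where \<open>h(p) = p - c - k (2 ln p - ln \<bar>k\<bar>)\<close> for \<open>p > c\<close> and \<open>h(p) = 0\<close>
  otherwise (\<open>strip_integrals\<close>). By the symmetry \<open>p \<leftrightarrow> q\<close>, the distribution function at
  \<open>0 < c \<le> 1\<close> is \<open>1 - 2 \<integral>\<^sub>c\<^sup>1 h(p) dp\<close> (\<open>cdf_area_ratio\<close>).

  The only term of \<open>h\<close> that is not immediate is \<open>k ln \<bar>k\<bar>\<close>, with \<open>k\<close> quadratic in \<open>p\<close> of
  discriminant \<open>1 - 4 c\<close>. If \<open>c \<le> 1/4\<close>, then \<open>k\<close> has real roots \<open>a\<close> and \<open>b = 1 - a\<close>, the logarithm
  splits into two, and the boundary terms contain only \<open>ln a\<close> and \<open>ln b\<close>, which recombine to \<open>ln c\<close>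
  and an \<open>artanh\<close> (\<open>has_integral_tail_term_real_roots\<close>). If \<open>c > 1/4\<close>, an arctangent appears
  instead, and a double-angle formula simplifies it (\<open>has_integral_tail_term_complex_roots\<close>).
  The limit at \<open>0\<close> needs no computation: a distribution function is continuous from the right.
\<close>

section \<open>Areas cut off by a hyperbola\<close>

definition clamp01 :: "real \<Rightarrow> real" where
  "clamp01 y = max 0 (min 1 y)"

lemma has_integral_hyperbola:
  fixes u p k :: real
  assumes "0 < u" "u \<le> p"
  shows "((\<lambda>x. p - k / x) has_integral (p * (p - u) - k * (ln p - ln u))) {u..p}"
proof -
  have "((\<lambda>x. p - k / x) has_integral (p * p - k * ln p) - (p * u - k * ln u)) {u..p}"
    by (rule fundamental_theorem_of_calculus)
       (use assms in \<open>auto intro!: derivative_eq_intros simp flip: has_real_derivative_iff_has_vector_derivative\<close>)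
  then show ?thesis by (simp add: algebra_simps)
qed

text \<open>
  The next three lemmas measure the points of \<open>{0..p} \<times> {p - 1..p}\<close> with \<open>x y > k\<close>: above each
  \<open>x > 0\<close>, they form a segment of length \<open>clamp01 (p - k / x)\<close>. If \<open>k \<ge> p\<^sup>2\<close>, not even the corner
  \<open>(p, p)\<close> satisfies the inequality.
\<close>

lemma has_integral_strip_zero:
  assumes "0 < p" "p\<^sup>2 \<le> k"
  shows "((\<lambda>x. clamp01 (p - k / x)) has_integral 0) {0..p}"
proof (rule has_integral_spike_finite[of "{0}"])
  fix x assume "x \<in> {0..p} - {0}"
  then have "0 < x" "x \<le> p" by auto
  then have "p * x \<le> k" using assms by (smt (verit) mult_left_mono power2_eq_square)
  then have "p \<le> k / x" using \<open>0 < x\<close> by (simp add: field_simps)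
  then show "clamp01 (p - k / x) = (\<lambda>_. 0) x" by (simp add: clamp01_def)
qed auto

text \<open>
  For \<open>k > 0\<close> the hyperbola enters the rectangle through its top side, at \<open>x = k / p\<close>. For \<open>k = 0\<close> it
  degenerates to the axes, and the factor \<open>k\<close> removes the arbitrary value \<open>ln 0\<close>.
\<close>

lemma has_integral_strip_nonneg:
  assumes p: "0 < p" "p \<le> 1" and k: "0 \<le> k" "k < p\<^sup>2"
  shows "((\<lambda>x. clamp01 (p - k / x)) has_integral (p\<^sup>2 - k - k * (2 * ln p - ln \<bar>k\<bar>))) {0..p}"
proof (cases "k = 0")
  case True
  have "((\<lambda>x. p) has_integral p\<^sup>2) {0..p}"
    using has_integral_const_real[of p 0 p] p by (simp add: power2_eq_square)
  then show ?thesis using True p by (simp add: clamp01_def)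
next
  case False
  define u where "u = k / p"
  have u: "0 < u" "u \<le> p" using False k p by (auto simp: u_def field_simps power2_eq_square)
  have "((\<lambda>x. clamp01 (p - k / x)) has_integral 0) {0..u}"
  proof (rule has_integral_spike_finite[of "{0}"])
    fix x assume "x \<in> {0..u} - {0}"
    then have "0 < x" "x \<le> k / p" by (auto simp: u_def)
    then have "p \<le> k / x" using p by (simp add: field_simps)
    then show "clamp01 (p - k / x) = (\<lambda>_. 0) x" by (simp add: clamp01_def)
  qed auto
  moreover have "((\<lambda>x. clamp01 (p - k / x)) has_integral (p * (p - u) - k * (ln p - ln u))) {u..p}"
  proof (rule has_integral_eq[OF _ has_integral_hyperbola[OF u]])
    fix x assume "x \<in> {u..p}"
    then have "0 < x" "k / p \<le> x" using u by (auto simp: u_def)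
    then have "0 \<le> p - k / x" "0 \<le> k / x" using p k by (auto simp: field_simps)
    then show "p - k / x = clamp01 (p - k / x)" using p by (simp add: clamp01_def)
  qed
  ultimately have "((\<lambda>x. clamp01 (p - k / x)) has_integral (0 + (p * (p - u) - k * (ln p - ln u)))) {0..p}"
    using u by (intro has_integral_combine[of 0 u p]) auto
  moreover have "0 + (p * (p - u) - k * (ln p - ln u)) = p\<^sup>2 - k - k * (2 * ln p - ln \<bar>k\<bar>)"
    using False k p by (simp add: u_def ln_div algebra_simps power2_eq_square)
  ultimately show ?thesis by simp
qed

text \<open>
  For \<open>k < 0\<close> the hyperbola enters through the bottom side \<open>y = p - 1\<close>, at \<open>x = - k / (1 - p)\<close>. To the
  left of that point the segment is the full height of the rectangle.
\<close>

lemma has_integral_strip_neg: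
  assumes p: "0 < p" "p < 1" and k: "k < 0" "- k < p * (1 - p)"
  shows "((\<lambda>x. clamp01 (p - k / x)) has_integral
           (p\<^sup>2 - k - k * (ln p + ln (1 - p) - ln \<bar>k\<bar>))) {0..p}"
proof -
  define u where "u = - k / (1 - p)"
  have u: "0 < u" "u \<le> p" using k p by (auto simp: u_def field_simps)
  have "((\<lambda>x. clamp01 (p - k / x)) has_integral u) {0..u}"
  proof (rule has_integral_spike_finite[of "{0}"])
    show "((\<lambda>_. 1) has_integral u) {0..u}"
      using has_integral_const_real[of "1::real" 0 u] u by simp
    fix x assume "x \<in> {0..u} - {0}"
    then have "0 < x" "x \<le> - k / (1 - p)" by (auto simp: u_def)
    then have "1 \<le> p - k / x" using p by (simp add: field_simps)
    then show "clamp01 (p - k / x) = (\<lambda>_. 1) x" by (simp add: clamp01_def)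
  qed auto
  moreover have "((\<lambda>x. clamp01 (p - k / x)) has_integral (p * (p - u) - k * (ln p - ln u))) {u..p}"
  proof (rule has_integral_eq[OF _ has_integral_hyperbola[OF u]])
    fix x assume "x \<in> {u..p}"
    then have "0 < x" "- k / (1 - p) \<le> x" using u by (auto simp: u_def)
    then have "p - k / x \<le> 1" "k / x \<le> 0" using p k by (auto simp: field_simps)
    then show "p - k / x = clamp01 (p - k / x)" using p by (simp add: clamp01_def)
  qed
  ultimately have "((\<lambda>x. clamp01 (p - k / x)) has_integral (u + (p * (p - u) - k * (ln p - ln u)))) {0..p}"
    using u by (intro has_integral_combine[of 0 u p]) auto
  moreover have "u + (p * (p - u) - k * (ln p - ln u))
      = p\<^sup>2 - k - k * (ln p + ln (1 - p) - ln \<bar>k\<bar>)"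
  proof -
    have "u * (1 - p) = - k" using p by (simp add: u_def)
    then have "u + p * (p - u) = p\<^sup>2 - k" by (simp add: algebra_simps power2_eq_square)
    moreover have "ln u = ln \<bar>k\<bar> - ln (1 - p)"
      using k p ln_div[of "- k" "1 - p"] by (simp add: u_def)
    then have "k * (ln p - ln u) = k * (ln p + ln (1 - p) - ln \<bar>k\<bar>)" by simp
    ultimately show ?thesis by linarith
  qed
  ultimately show ?thesis by simp
qed

definition tail_term :: "real \<Rightarrow> real \<Rightarrow> real" where
  "tail_term c p = p - c - (p\<^sup>2 - p + c) * (2 * ln p - ln \<bar>p\<^sup>2 - p + c\<bar>)"

text \<open>
  Twice the integral of this function over the unit interval is the probability that the ratio
  exceeds \<open>c\<close>. It is not itself a conditional probability (it may be negative): only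
  \<open>cut_tail_term c p + cut_tail_term c (1 - p)\<close> is.
\<close>

definition cut_tail_term :: "real \<Rightarrow> real \<Rightarrow> real" where
  "cut_tail_term c p = (if c < p then tail_term c p else 0)"

text \<open>
  For \<open>k < 0\<close> the two areas contain \<open>ln p + ln (1 - p)\<close> rather than \<open>2 ln p\<close> and \<open>2 ln (1 - p)\<close>. The
  discrepancies cancel in the sum, so that one formula covers all signs of \<open>k\<close>. Moreover \<open>k < 0\<close>
  means \<open>c < p (1 - p)\<close>, which forces both \<open>p\<close> and \<open>1 - p\<close> above \<open>c\<close>. For \<open>k \<ge> 0\<close> the areas agree
  with the two terms separately, because \<open>k < p\<^sup>2\<close> is the same as \<open>c < p\<close>.
\<close>

lemma strip_integrals:
  assumes p: "0 < p" "p < 1" and c: "0 < c"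
  obtains I J where
    "((\<lambda>x. clamp01 (p - (p\<^sup>2 - p + c) / x)) has_integral I) {0..p}"
    "((\<lambda>x. clamp01 ((1 - p) - (p\<^sup>2 - p + c) / x)) has_integral J) {0..1 - p}"
    "I + J = cut_tail_term c p + cut_tail_term c (1 - p)"
proof -
  define k where "k = p\<^sup>2 - p + c"
  have sym: "(1 - p)\<^sup>2 - (1 - p) + c = k" by (simp add: k_def power2_eq_square algebra_simps)
  show ?thesis
  proof (cases "k < 0")
    case True
    have kb: "- k < p * (1 - p)" using c by (simp add: k_def power2_eq_square algebra_simps)
    have "c < p * (1 - p)" using True by (simp add: k_def power2_eq_square algebra_simps)
    moreover have "p * (1 - p) < p * 1" "p * (1 - p) < 1 * (1 - p)"
      using p by (intro mult_strict_left_mono mult_strict_right_mono; simp)+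
    ultimately have cp: "c < p" "c < 1 - p" by (simp_all only: mult_1_right mult_1_left)
    show ?thesis
      by (rule that[OF has_integral_strip_neg[OF p True kb, unfolded k_def]
            has_integral_strip_neg[of "1 - p" k, unfolded k_def]])
         (use p True kb cp in \<open>auto simp: k_def cut_tail_term_def tail_term_def sym[unfolded k_def]
            algebra_simps power2_eq_square\<close>)
  next
    case False
    have *: "((\<lambda>x. clamp01 (r - k / x)) has_integral cut_tail_term c r) {0..r}"
      if r: "0 < r" "r < 1" "k = r\<^sup>2 - r + c" for r
    proof (cases "c < r")
      case True
      then show ?thesis
        using has_integral_strip_nonneg[of r k] r False by (simp add: cut_tail_term_def tail_term_def)
    next
      case F: False
      then show ?thesis
        using has_integral_strip_zero[of r k] r by (simp add: cut_tail_term_def)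
    qed
    show ?thesis
      by (rule that[OF *[of p, unfolded k_def] *[of "1 - p", unfolded k_def]])
         (use p sym in \<open>auto simp: k_def\<close>)
  qed
qed

section \<open>The tail integral in closed form\<close>

text \<open>
  The interval may contain the root \<open>a\<close>, where the logarithm is undefined. The polynomial factor
  in front of the logarithm is the primitive of \<open>(p - a) (p - b)\<close> that vanishes at \<open>a\<close>, to at least
  second order. This makes the antiderivative continuous there, which is all that the fundamental theorem
  requires at an exceptional point.
\<close>

lemma has_integral_quadratic_ln_root:
  fixes a b x y :: real
  defines "F \<equiv> \<lambda>p. ((p - a)^3 / 3 + (a - b) * (p - a)\<^sup>2 / 2) * ln \<bar>p - a\<bar>
                    - (p - a)^3 / 9 - (a - b) * (p - a)\<^sup>2 / 4"
  assumes "x \<le> y"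
  shows "((\<lambda>p. (p - a) * (p - b) * ln \<bar>p - a\<bar>) has_integral F y - F x) {x..y}"
proof (rule fundamental_theorem_of_calculus_strong[where S = "{a}"])
  define g :: "real \<Rightarrow> real" where "g = (\<lambda>u. u\<^sup>2 * ln \<bar>u\<bar>)"
  have "isCont g u" for u
  proof (cases "u = 0")
    case True
    have "((\<lambda>u::real. u\<^sup>2 * ln \<bar>u\<bar>) \<longlongrightarrow> 0) (at 0)"
      by real_asymp
    then show ?thesis using True by (simp add: g_def isCont_def)
  next
    case False
    then show ?thesis unfolding g_def by (intro continuous_intros) auto
  qed
  then have "continuous_on UNIV g"
    by (simp add: continuous_at_imp_continuous_on)
  then have "continuous_on {x..y} (\<lambda>p. g (p - a))"
    by (rule continuous_on_compose2) (auto intro!: continuous_intros)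
  then have "continuous_on {x..y} (\<lambda>p. ((p - a) / 3 + (a - b) / 2) * g (p - a)
               - (p - a)^3 / 9 - (a - b) * (p - a)\<^sup>2 / 4)"
    by (intro continuous_intros) auto
  moreover have "F p = ((p - a) / 3 + (a - b) / 2) * g (p - a)
               - (p - a)^3 / 9 - (a - b) * (p - a)\<^sup>2 / 4" for p
    unfolding F_def g_def power3_eq_cube power2_eq_square by (simp add: distrib_right)
  ultimately show "continuous_on {x..y} F" by simp
next
  fix p assume "p \<in> {x..y} - {a}"
  then have "p \<noteq> a" by auto
  have D: "((\<lambda>p. ln \<bar>p - a\<bar>) has_field_derivative 1 / (p - a)) (at p)"
  proof (cases "a < p")
    case True
    then have "((\<lambda>p. ln (p - a)) has_field_derivative 1 / (p - a)) (at p)"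
      by (auto intro!: derivative_eq_intros)
    then show ?thesis
      by (rule has_field_derivative_transform_within_open[where S = "{a<..}"]) (use True in auto)
  next
    case False
    with \<open>p \<noteq> a\<close> have "p < a" by simp
    then have "((\<lambda>p. ln (a - p)) has_field_derivative 1 / (p - a)) (at p)"
      by (auto intro!: derivative_eq_intros simp: field_simps)
    then show ?thesis
      by (rule has_field_derivative_transform_within_open[where S = "{..<a}"]) (use \<open>p < a\<close> in auto)
  qed
  have P: "((\<lambda>p. (p - a)^3 / 3 + (a - b) * (p - a)\<^sup>2 / 2) has_field_derivative
      (p - a) * (p - b)) (at p)"
    by (auto intro!: derivative_eq_intros simp: power2_eq_square field_simps)
  have R: "((\<lambda>p. (p - a)^3 / 9) has_field_derivative (p - a)\<^sup>2 / 3) (at p)"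
    by (auto intro!: derivative_eq_intros)
  have T: "((\<lambda>p. (a - b) * (p - a)\<^sup>2 / 4) has_field_derivative (a - b) * (p - a) / 2) (at p)"
    by (auto intro!: derivative_eq_intros)
  have "1 / (p - a) * ((p - a)^3 / 3 + (a - b) * (p - a)\<^sup>2 / 2)
      = (p - a)\<^sup>2 / 3 + (a - b) * (p - a) / 2"
    using \<open>p \<noteq> a\<close> by (simp add: power2_eq_square power3_eq_cube distrib_left)
  then have "(F has_field_derivative (p - a) * (p - b) * ln \<bar>p - a\<bar>) (at p)"
    using DERIV_diff[OF DERIV_diff[OF DERIV_mult[OF P D] R] T] by (simp add: F_def)
  then show "(F has_vector_derivative (p - a) * (p - b) * ln \<bar>p - a\<bar>) (at p)"
    by (simp add: has_real_derivative_iff_has_vector_derivative)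
qed (use assms in auto)

lemma has_integral_tail_term_polynomial_part:
  fixes c :: real
  assumes "0 < c" "c \<le> 1"
  shows "((\<lambda>p. p - c - 2 * (p\<^sup>2 - p + c) * ln p) has_integral
          (1 - c)\<^sup>2 / 2 + 2 * (c^3 / 3 + c\<^sup>2 / 2) * ln c
            + 2 * ((1 - c^3) / 9 - (1 - c\<^sup>2) / 4 + c * (1 - c))) {c..1}"
proof -
  define F where "F p = p\<^sup>2 / 2 - c * p - 2 * (p^3 / 3 - p\<^sup>2 / 2 + c * p) * ln p
    + 2 * (p^3 / 9 - p\<^sup>2 / 4 + c * p)" for p :: real
  have "((\<lambda>p. p - c - 2 * (p\<^sup>2 - p + c) * ln p) has_integral F 1 - F c) {c..1}"
  proof (rule fundamental_theorem_of_calculus)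
    fix p assume "p \<in> {c..1}"
    then have "0 < p" using assms by auto
    then have "(F has_field_derivative p - c - 2 * (p\<^sup>2 - p + c) * ln p) (at p)"
      unfolding F_def
      by (auto intro!: derivative_eq_intros simp: field_simps power2_eq_square power3_eq_cube)
    then show "(F has_vector_derivative p - c - 2 * (p\<^sup>2 - p + c) * ln p) (at p within {c..1})"
      by (auto simp flip: has_real_derivative_iff_has_vector_derivative intro: DERIV_subset)
  qed (use assms in auto)
  then show ?thesis
    by (rule has_integral_eq_rhs) (simp add: F_def field_simps power2_eq_square power3_eq_cube)
qed

lemma powr_three_halves:
  fixes x :: real
  assumes "0 \<le> x"
  shows "x powr (3/2) = sqrt x ^ 3"
proof -
  have "sqrt x ^ 3 = sqrt x powr 3" using assms by (simp add: powr_numeral)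
  also have "\<dots> = x powr (3/2)"
    using assms by (simp add: powr_half_sqrt[symmetric] powr_powr)
  finally show ?thesis ..
qed

text \<open>
  With roots \<open>a\<close> and \<open>b = 1 - a\<close> of \<open>p\<^sup>2 - p + c\<close> one has \<open>c = a b\<close>, hence \<open>c - a = - a\<^sup>2\<close> and
  \<open>c - b = - b\<^sup>2\<close>. So every logarithm at the end points \<open>c\<close> and \<open>1\<close> is a multiple of \<open>ln a\<close> or
  \<open>ln b\<close>, and the claim reduces to three polynomial identities in \<open>a\<close>. The double root at
  \<open>c = 1/4\<close> is included.
\<close>

lemma has_integral_tail_term_real_roots:
  fixes c :: real
  assumes c: "0 < c" "c \<le> 1/4"
  defines "F \<equiv> c - (3 * c - 1/2) * ln c + (1 - 4 * c) powr (3/2) * artanh (sqrt (1 - 4 * c))"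
  shows "(tail_term c has_integral (1 - F) / 2) {c..1}"
proof -
  define d where "d = sqrt (1 - 4 * c)"
  define a where "a = (1 - d) / 2"
  define b where "b = 1 - a"
  have d2: "d\<^sup>2 = 1 - 4 * c" and d0: "0 \<le> d" using c by (auto simp: d_def)
  have d1: "d < 1" using c by (auto simp: d_def)
  have a: "0 < a" "a < 1" using d0 d1 by (auto simp: a_def)
  have da: "d = 1 - 2 * a" by (simp add: a_def field_simps)
  have ca: "c = a * (1 - a)" using d2 unfolding da by (simp add: power2_eq_square algebra_simps)
  have lnc: "ln c = ln a + ln (1 - a)" using a by (simp add: ca ln_mult)
  have lnca: "ln \<bar>c - a\<bar> = 2 * ln a"
  proof -
    have "\<bar>c - a\<bar> = a\<^sup>2" by (simp add: ca algebra_simps power2_eq_square)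
    then show ?thesis using a by (simp add: ln_realpow)
  qed
  have lncb: "ln \<bar>c - b\<bar> = 2 * ln (1 - a)"
  proof -
    have "c - b = - (1 - a)\<^sup>2" by (simp add: ca b_def algebra_simps power2_eq_square)
    then have "\<bar>c - b\<bar> = (1 - a)\<^sup>2" by simp
    then show ?thesis using a by (simp add: ln_realpow)
  qed
  have powr: "(1 - 4 * c) powr (3/2) = d^3"
    using c powr_three_halves[of "1 - 4 * c"] by (simp add: d_def)
  have art: "artanh (sqrt (1 - 4 * c)) = (ln (1 - a) - ln a) / 2"
  proof -
    have "(1 + d) / (1 - d) = (1 - a) / a" using a by (simp add: da field_simps)
    then show ?thesis using a unfolding d_def[symmetric] artanh_def by (simp add: ln_div)
  qed
  have eq: "p - c - 2 * (p\<^sup>2 - p + c) * ln p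
      + ((p - a) * (p - b) * ln \<bar>p - a\<bar> + (p - b) * (p - a) * ln \<bar>p - b\<bar>) = tail_term c p" for p
  proof -
    have k: "p\<^sup>2 - p + c = (p - a) * (p - b)"
      by (simp add: ca b_def algebra_simps power2_eq_square)
    show ?thesis
    proof (cases "p = a \<or> p = b")
      case True
      then show ?thesis unfolding tail_term_def k by auto
    next
      case False
      then have "ln \<bar>(p - a) * (p - b)\<bar> = ln \<bar>p - a\<bar> + ln \<bar>p - b\<bar>"
        by (simp add: abs_mult ln_mult)
      then show ?thesis unfolding tail_term_def k by (simp add: algebra_simps)
    qed
  qed
  have "(tail_term c has_integral
     ((1 - c)\<^sup>2 / 2 + 2 * (c^3 / 3 + c\<^sup>2 / 2) * ln c
            + 2 * ((1 - c^3) / 9 - (1 - c\<^sup>2) / 4 + c * (1 - c)))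
     + (((((1 - a)^3 / 3 + (a - b) * (1 - a)\<^sup>2 / 2) * ln \<bar>1 - a\<bar>
                    - (1 - a)^3 / 9 - (a - b) * (1 - a)\<^sup>2 / 4)
       - (((c - a)^3 / 3 + (a - b) * (c - a)\<^sup>2 / 2) * ln \<bar>c - a\<bar>
                    - (c - a)^3 / 9 - (a - b) * (c - a)\<^sup>2 / 4))
     + ((((1 - b)^3 / 3 + (b - a) * (1 - b)\<^sup>2 / 2) * ln \<bar>1 - b\<bar>
                    - (1 - b)^3 / 9 - (b - a) * (1 - b)\<^sup>2 / 4)
       - (((c - b)^3 / 3 + (b - a) * (c - b)\<^sup>2 / 2) * ln \<bar>c - b\<bar>
                    - (c - b)^3 / 9 - (b - a) * (c - b)\<^sup>2 / 4)))) {c..1}" (is "(_ has_integral ?I) _")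
    unfolding eq[symmetric, abs_def]
    by (intro has_integral_add has_integral_tail_term_polynomial_part has_integral_quadratic_ln_root)
       (use c in auto)
  also have "?I = (1 - F) / 2"
  proof -
    have abs: "\<bar>1 - a\<bar> = 1 - a" "\<bar>1 - b\<bar> = a" using a by (auto simp: b_def)
    have shift: "c - a = - a\<^sup>2" "c - b = - (1 - a)\<^sup>2" "1 - b = a"
      by (simp_all add: ca b_def algebra_simps power2_eq_square)
    \<comment> \<open>Collects the coefficients of \<open>X = ln a\<close> and \<open>Y = ln (1 - a)\<close>.\<close>
    have regroup: "P + q * (X + Y) + r + (((A1 * Y - B1 - C1) - (A2 * (2 * X) - B2 - C2))
          + ((A3 * X - B3 - C3) - (A4 * (2 * Y) - B4 - C4)))
        = (q - A2 * 2 + A3) * X + (q + A1 - A4 * 2) * Y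
          + (P + r + ((- B1 - C1) - (- B2 - C2) + ((- B3 - C3) - (- B4 - C4))))"
      for P q r X Y A1 A2 A3 A4 B1 B2 B3 B4 C1 C2 C3 C4 :: real
      by (simp add: algebra_simps)
    have coeff_a: "2 * (c^3 / 3 + c\<^sup>2 / 2) - ((- a\<^sup>2)^3 / 3 + (a - b) * (- a\<^sup>2)\<^sup>2 / 2) * 2
        + (a^3 / 3 + (b - a) * a\<^sup>2 / 2) = ((3 * c - 1/2) + d^3 / 2) / 2"
      unfolding ca b_def da by (simp add: field_simps power2_eq_square power3_eq_cube)
    have coeff_b: "2 * (c^3 / 3 + c\<^sup>2 / 2) + ((1 - a)^3 / 3 + (a - b) * (1 - a)\<^sup>2 / 2)
        - ((- (1 - a)\<^sup>2)^3 / 3 + (b - a) * (- (1 - a)\<^sup>2)\<^sup>2 / 2) * 2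
        = ((3 * c - 1/2) - d^3 / 2) / 2"
      unfolding ca b_def da by (simp add: field_simps power2_eq_square power3_eq_cube)
    have const: "(1 - c)\<^sup>2 / 2 + 2 * ((1 - c^3) / 9 - (1 - c\<^sup>2) / 4 + c * (1 - c))
        + ((- ((1 - a)^3 / 9) - (a - b) * (1 - a)\<^sup>2 / 4)
           - (- ((- a\<^sup>2)^3 / 9) - (a - b) * (- a\<^sup>2)\<^sup>2 / 4)
         + ((- (a^3 / 9) - (b - a) * a\<^sup>2 / 4)
           - (- ((- (1 - a)\<^sup>2)^3 / 9) - (b - a) * (- (1 - a)\<^sup>2)\<^sup>2 / 4)))
        = (1 - c) / 2"
      unfolding ca b_def da by (simp add: field_simps power2_eq_square power3_eq_cube)
    show ?thesis
      unfolding F_def powr art abs lnc lnca lncb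
      unfolding shift regroup coeff_a coeff_b const
      by (simp add: field_simps)
  qed
  finally show ?thesis .
qed

text \<open>
  Integration by parts in the variable \<open>p - 1/2\<close>, in which \<open>p\<^sup>2 - p + c\<close> is the even polynomial
  \<open>(p - 1/2)\<^sup>2 + e\<^sup>2 / 4\<close>. The arctangent comes from the constant remainder of the polynomial division.
\<close>

lemma has_integral_quadratic_ln:
  fixes c x y :: real
  assumes c: "1/4 < c" and "x \<le> y"
  defines "e \<equiv> sqrt (4 * c - 1)"
  defines "F \<equiv> \<lambda>p. ((p - 1/2)^3 / 3 + (c - 1/4) * (p - 1/2)) * ln (p\<^sup>2 - p + c)
     - 2 * (p - 1/2)^3 / 9 - 4 * (c - 1/4) * (p - 1/2) / 3 + e^3 / 6 * arctan ((2 * p - 1) / e)"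
  shows "((\<lambda>p. (p\<^sup>2 - p + c) * ln (p\<^sup>2 - p + c)) has_integral F y - F x) {x..y}"
proof (rule fundamental_theorem_of_calculus)
  fix p assume "p \<in> {x..y}"
  have e: "0 < e" and e2: "e\<^sup>2 = 4 * c - 1" using c by (auto simp: e_def)
  have k: "0 < p\<^sup>2 - p + c"
    using c sum_power2_ge_zero[of "p - 1/2" 0] by (simp add: power2_eq_square algebra_simps)
  have A: "((\<lambda>p. e^3 / 6 * arctan ((2 * p - 1) / e)) has_field_derivative
     (4 * c - 1)\<^sup>2 / 12 / (p\<^sup>2 - p + c)) (at p)"
  proof -
    have q: "1 + ((2 * p - 1) / e)\<^sup>2 = 4 * (p\<^sup>2 - p + c) / e\<^sup>2"
    proof -
      have "1 + ((2 * p - 1) / e)\<^sup>2 = (e\<^sup>2 + (2 * p - 1)\<^sup>2) / e\<^sup>2"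
        using e by (simp add: field_simps)
      also have "e\<^sup>2 + (2 * p - 1)\<^sup>2 = 4 * (p\<^sup>2 - p + c)"
        unfolding e2 by (simp add: power2_eq_square algebra_simps)
      finally show ?thesis .
    qed
    have "((\<lambda>p. e^3 / 6 * arctan ((2 * p - 1) / e)) has_field_derivative
        e^3 / 6 * (inverse (1 + ((2 * p - 1) / e)\<^sup>2) * (2 / e))) (at p)"
      by (rule derivative_eq_intros refl | use e in force)+
    also have "e^3 / 6 * (inverse (1 + ((2 * p - 1) / e)\<^sup>2) * (2 / e)) = (e\<^sup>2)\<^sup>2 / 12 / (p\<^sup>2 - p + c)"
      unfolding q using e k by (simp add: field_simps power2_eq_square power3_eq_cube)
    finally show ?thesis unfolding e2 .
  qed
  have L: "((\<lambda>p. ln (p\<^sup>2 - p + c)) has_field_derivative (2 * p - 1) / (p\<^sup>2 - p + c)) (at p)"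
    using k by (auto intro!: derivative_eq_intros)
  have P: "((\<lambda>p. (p - 1/2)^3 / 3 + (c - 1/4) * (p - 1/2)) has_field_derivative
      (p - 1/2)\<^sup>2 + (c - 1/4)) (at p)"
    by (auto intro!: derivative_eq_intros)
  have R: "((\<lambda>p. 2 * (p - 1/2)^3 / 9) has_field_derivative 2 * (p - 1/2)\<^sup>2 / 3) (at p)"
    by (auto intro!: derivative_eq_intros)
  have T: "((\<lambda>p. 4 * (c - 1/4) * (p - 1/2) / 3) has_field_derivative 4 * (c - 1/4) / 3) (at p)"
    by (auto intro!: derivative_eq_intros)
  have "(F has_field_derivative
      ((p - 1/2)\<^sup>2 + (c - 1/4)) * ln (p\<^sup>2 - p + c)
      + ((p - 1/2)^3 / 3 + (c - 1/4) * (p - 1/2)) * ((2 * p - 1) / (p\<^sup>2 - p + c))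
      - 2 * (p - 1/2)\<^sup>2 / 3 - 4 * (c - 1/4) / 3 + (4 * c - 1)\<^sup>2 / 12 / (p\<^sup>2 - p + c)) (at p)"
    using DERIV_add[OF DERIV_diff[OF DERIV_diff[OF DERIV_mult[OF P L] R] T] A]
    by (simp add: F_def mult.commute)
  also have "((p - 1/2)\<^sup>2 + (c - 1/4)) * ln (p\<^sup>2 - p + c)
      + ((p - 1/2)^3 / 3 + (c - 1/4) * (p - 1/2)) * ((2 * p - 1) / (p\<^sup>2 - p + c))
      - 2 * (p - 1/2)\<^sup>2 / 3 - 4 * (c - 1/4) / 3 + (4 * c - 1)\<^sup>2 / 12 / (p\<^sup>2 - p + c)
    = (p\<^sup>2 - p + c) * ln (p\<^sup>2 - p + c)"
  proof -
    have "((p - 1/2)^3 / 3 + (c - 1/4) * (p - 1/2)) * (2 * p - 1) + (4 * c - 1)\<^sup>2 / 12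
       = (2 * (p - 1/2)\<^sup>2 / 3 + 4 * (c - 1/4) / 3) * (p\<^sup>2 - p + c)"
      by (simp add: field_simps) algebra
    moreover have "X * (m / k) + Y / k = (X * m + Y) / k" for X Y m k :: real
      by (simp add: add_divide_distrib)
    ultimately have "((p - 1/2)^3 / 3 + (c - 1/4) * (p - 1/2)) * ((2 * p - 1) / (p\<^sup>2 - p + c))
         + (4 * c - 1)\<^sup>2 / 12 / (p\<^sup>2 - p + c) = 2 * (p - 1/2)\<^sup>2 / 3 + 4 * (c - 1/4) / 3"
      using k by (simp only: nonzero_mult_div_cancel_right[OF less_imp_neq[OF k, symmetric]])
    moreover have sq: "(p - 1/2)\<^sup>2 + (c - 1/4) = p\<^sup>2 - p + c"
      by (simp add: power2_eq_square algebra_simps)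
    ultimately show ?thesis unfolding sq by linarith
  qed
  finally show "(F has_vector_derivative (p\<^sup>2 - p + c) * ln (p\<^sup>2 - p + c)) (at p within {x..y})"
    by (auto simp flip: has_real_derivative_iff_has_vector_derivative intro: DERIV_subset)
qed (use assms in auto)

text \<open>
  Since \<open>4 c = 1 + e\<^sup>2\<close>, the left-hand side is the value of the arctangent at the end point \<open>p = c\<close>.
\<close>

lemma arctan_double_angle:
  assumes "0 < e"
  shows "arctan ((e\<^sup>2 - 1) / (2 * e)) = 2 * arctan e - pi / 2"
proof (rule arctan_unique)
  have b: "0 < arctan e" "arctan e < pi / 2" using assms arctan_ubound by auto
  then show "- (pi / 2) < 2 * arctan e - pi / 2" "2 * arctan e - pi / 2 < pi / 2" by auto
  have s: "sin (arctan e) = e / sqrt (1 + e\<^sup>2)" "cos (arctan e) = 1 / sqrt (1 + e\<^sup>2)"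
    by (auto simp: sin_arctan cos_arctan)
  have "1 + e\<^sup>2 > 0" by (simp add: add_pos_nonneg)
  then have c2: "cos (2 * arctan e) = (1 - e\<^sup>2) / (1 + e\<^sup>2)"
    and s2: "sin (2 * arctan e) = 2 * e / (1 + e\<^sup>2)"
    by (simp_all add: cos_double sin_double s power_divide diff_divide_distrib
          flip: power2_eq_square)
  have "tan (2 * arctan e - pi / 2) = - (cos (2 * arctan e) / sin (2 * arctan e))"
    by (simp add: tan_def sin_diff cos_diff)
  also have "\<dots> = (e\<^sup>2 - 1) / (2 * e)"
    using assms \<open>1 + e\<^sup>2 > 0\<close> unfolding c2 s2 by (simp add: divide_simps)
  finally show "tan (2 * arctan e - pi / 2) = (e\<^sup>2 - 1) / (2 * e)" .
qed

lemma has_integral_tail_term_complex_roots: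
  fixes c :: real
  assumes c: "1/4 < c" "c \<le> 1"
  defines "F \<equiv> c - (3 * c - 1/2) * ln c + (4 * c - 1) powr (3/2) * (arctan (sqrt (4 * c - 1)) - pi / 3)"
  shows "(tail_term c has_integral (1 - F) / 2) {c..1}"
proof -
  define e where "e = sqrt (4 * c - 1)"
  have e: "0 < e" and e2: "e\<^sup>2 = 4 * c - 1" using c by (auto simp: e_def)
  have powr: "(4 * c - 1) powr (3/2) = e^3"
    using c powr_three_halves[of "4 * c - 1"] by (simp add: e_def)
  have a1: "arctan ((2 * 1 - 1) / e) = pi / 2 - arctan e"
    using arctan_inverse[of e] e by (simp add: inverse_eq_divide)
  have "(2 * c - 1) / e = (e\<^sup>2 - 1) / (2 * e)" unfolding e2 using e by (simp add: divide_simps)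
  then have a2: "arctan ((2 * c - 1) / e) = 2 * arctan e - pi / 2"
    using arctan_double_angle[OF e] by simp
  have k1: "1\<^sup>2 - 1 + c = c" and kc: "ln (c\<^sup>2 - c + c) = 2 * ln c"
    using c by (auto simp: ln_realpow)
  have eq: "p - c - 2 * (p\<^sup>2 - p + c) * ln p + (p\<^sup>2 - p + c) * ln (p\<^sup>2 - p + c) = tail_term c p" for p
  proof -
    have "0 < p\<^sup>2 - p + c"
      using c sum_power2_ge_zero[of "p - 1/2" 0] by (simp add: power2_eq_square algebra_simps)
    then show ?thesis by (simp add: tail_term_def algebra_simps)
  qed
  note quad = has_integral_quadratic_ln[OF c(1) c(2), folded e_def, unfolded a1 a2 k1 kc]
  have "0 < c" using c by simp
  note int = has_integral_add[OF has_integral_tail_term_polynomial_part[OF this c(2)] quad]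
  have "((\<lambda>p. p - c - 2 * (p\<^sup>2 - p + c) * ln p + (p\<^sup>2 - p + c) * ln (p\<^sup>2 - p + c))
     has_integral (1 - F) / 2) {c..1}"
  proof (rule has_integral_eq_rhs[OF int])
    \<comment> \<open>Collects the coefficients of \<open>X = ln c\<close>, of \<open>Y = arctan e\<close> and of \<open>Z = pi\<close>.\<close>
    have regroup: "r + q * X + s + ((A * X - B1 - C1 + E * (Z / 2 - Y))
          - (D * (2 * X) - B2 - C2 + E * (2 * Y - Z / 2)))
        = (q + A - D * 2) * X + (r + s - B1 - C1 + B2 + C2) + E * (Z - 3 * Y)"
      for q r s A B1 B2 C1 C2 D E X Y Z :: real
      by (simp add: algebra_simps)
    have coeff: "2 * (c^3 / 3 + c\<^sup>2 / 2) + ((1 - 1/2)^3 / 3 + (c - 1/4) * (1 - 1/2))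
        - ((c - 1/2)^3 / 3 + (c - 1/4) * (c - 1/2)) * 2 = (3 * c - 1/2) / 2"
      by (simp add: field_simps power2_eq_square power3_eq_cube)
    have const: "(1 - c)\<^sup>2 / 2 + 2 * ((1 - c^3) / 9 - (1 - c\<^sup>2) / 4 + c * (1 - c))
        - 2 * (1 - 1/2)^3 / 9 - 4 * (c - 1/4) * (1 - 1/2) / 3
        + 2 * (c - 1/2)^3 / 9 + 4 * (c - 1/4) * (c - 1/2) / 3 = (1 - c) / 2"
      by (simp add: field_simps power2_eq_square power3_eq_cube)
    show "(1 - F) / 2 = (1 - c)\<^sup>2 / 2 + 2 * (c^3 / 3 + c\<^sup>2 / 2) * ln c
      + 2 * ((1 - c^3) / 9 - (1 - c\<^sup>2) / 4 + c * (1 - c))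
      + ((((1 - 1/2)^3 / 3 + (c - 1/4) * (1 - 1/2)) * ln c - 2 * (1 - 1/2)^3 / 9
            - 4 * (c - 1/4) * (1 - 1/2) / 3 + e^3 / 6 * (pi / 2 - arctan e))
        - (((c - 1/2)^3 / 3 + (c - 1/4) * (c - 1/2)) * (2 * ln c) - 2 * (c - 1/2)^3 / 9
            - 4 * (c - 1/4) * (c - 1/2) / 3 + e^3 / 6 * (2 * arctan e - pi / 2)))"
      unfolding F_def powr e_def[symmetric]
      unfolding regroup coeff const by (simp add: field_simps)
  qed
  then show ?thesis unfolding eq[symmetric, abs_def] by simp
qed

section \<open>The distribution of the area ratio\<close>

abbreviation unif :: "real measure" where
  "unif \<equiv> uniform_measure lborel {0..1}"

definition area_ratio :: "real \<Rightarrow> real \<Rightarrow> real \<Rightarrow> real" where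
  "area_ratio r s t = r * s * t + (1 - r) * (1 - s) * (1 - t)"

lemma area_ratio_shift:
  "area_ratio p s t = (s - (1 - p)) * (t - (1 - p)) + p * (1 - p)"
  by (simp add: area_ratio_def algebra_simps)

lemma emeasure_upper_part: "emeasure lborel {t \<in> {0..1}. v < t} = ennreal (clamp01 (1 - v))"
proof -
  consider "v < 0" | "0 \<le> v" "v \<le> 1" | "1 < v" by linarith
  then show ?thesis
  proof cases
    case 1
    then have eq: "{t \<in> {0..1}. v < t} = {0..1}" by auto
    show ?thesis unfolding eq using 1 by (simp add: clamp01_def)
  next
    case 2
    then have eq: "{t \<in> {0..1}. v < t} = {v<..1}" by auto
    show ?thesis unfolding eq using 2 by (simp add: clamp01_def)
  next
    case 3
    then have eq: "{t \<in> {0..1}. v < t} = {}" by auto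
    show ?thesis unfolding eq using 3 by (simp add: clamp01_def)
  qed
qed

lemma emeasure_lower_part: "emeasure lborel {t \<in> {0..1}. t < v} = ennreal (clamp01 v)"
proof -
  consider "v < 0" | "0 \<le> v" "v \<le> 1" | "1 < v" by linarith
  then show ?thesis
  proof cases
    case 1
    then have eq: "{t \<in> {0..1}. t < v} = {}" by auto
    show ?thesis unfolding eq using 1 by (simp add: clamp01_def)
  next
    case 2
    then have eq: "{t \<in> {0..1}. t < v} = {0..<v}" by auto
    show ?thesis unfolding eq using 2 by (simp add: clamp01_def)
  next
    case 3
    then have eq: "{t \<in> {0..1}. t < v} = {0..1}" by auto
    show ?thesis unfolding eq using 3 by (simp add: clamp01_def)
  qed
qed

text \<open>
  On the line \<open>s = q\<close> the fibre may differ from the one described by \<open>f\<close>, whose value there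
  is arbitrary. Nonnegativity is recorded because the last integration is over \<open>ennreal\<close>, where a
  negative value would be truncated.
\<close>

lemma section_area:
  assumes p: "0 < p" "p < 1" and c: "0 < c"
  shows "(\<integral>\<^sup>+s. emeasure lborel {t \<in> {0..1}. c < area_ratio p s t} * indicator {0..1} s \<partial>lborel)
           = ennreal (cut_tail_term c p + cut_tail_term c (1 - p))"
    and "0 \<le> cut_tail_term c p + cut_tail_term c (1 - p)"
proof -
  define k where "k = p\<^sup>2 - p + c"
  define q where "q = 1 - p"
  define f where "f s = (if s < q then clamp01 (q - k / (q - s)) else clamp01 (p - k / (s - q)))" for s
  have f0: "0 \<le> f s" for s by (auto simp: f_def clamp01_def)
  obtain I J where
    I: "((\<lambda>x. clamp01 (p - k / x)) has_integral I) {0..p}" and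
    J: "((\<lambda>x. clamp01 (q - k / x)) has_integral J) {0..q}" and
    IJ: "I + J = cut_tail_term c p + cut_tail_term c (1 - p)"
    using strip_integrals[OF p c] unfolding k_def q_def by metis
  have "((\<lambda>s. clamp01 (p - k / (s + - q))) has_integral I) {0 - - q..p - - q}"
    by (rule has_integral_shift_real_ivl[OF I])
  moreover have "p + q = 1" by (simp add: q_def)
  ultimately have "((\<lambda>s. clamp01 (p - k / (s - q))) has_integral I) {q..1}"
    by simp
  then have upper: "(f has_integral I) {q..1}"
    by (rule has_integral_eq[rotated]) (auto simp: f_def)
  have "((\<lambda>x. clamp01 (q - k / - x)) has_integral J) {-q..-0}"
    using J by (subst has_integral_reflect_real)
  then have "((\<lambda>s. clamp01 (q - k / - (s + - q))) has_integral J) {- q - - q..- 0 - - q}"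
    by (rule has_integral_shift_real_ivl)
  then have "((\<lambda>s. clamp01 (q - k / (q - s))) has_integral J) {0..q}"
    by simp
  then have lower: "(f has_integral J) {0..q}"
    by (rule has_integral_spike_finite[of "{q}", rotated 2]) (auto simp: f_def)
  have int: "(f has_integral (J + I)) {0..1}"
    using p by (intro has_integral_combine[OF _ _ lower upper]) (auto simp: q_def)
  then show "0 \<le> cut_tail_term c p + cut_tail_term c (1 - p)"
    using has_integral_nonneg[OF int f0] IJ by simp
  have sec: "emeasure lborel {t \<in> {0..1}. c < area_ratio p s t} = ennreal (f s)" if "s \<noteq> q" for s
  proof -
    have iff: "c < area_ratio p s t \<longleftrightarrow> k < (s - q) * (t - q)" for t
      by (simp add: area_ratio_shift k_def q_def power2_eq_square algebra_simps)
    show ?thesis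
    proof (cases "s < q")
      case True
      then have "c < area_ratio p s t \<longleftrightarrow> t < q - k / (q - s)" for t
        unfolding iff by (simp add: field_simps)
      then have "{t \<in> {0..1}. c < area_ratio p s t} = {t \<in> {0..1}. t < q - k / (q - s)}"
        by blast
      then show ?thesis using True by (simp only: emeasure_lower_part f_def if_True)
    next
      case False
      then have "c < area_ratio p s t \<longleftrightarrow> q + k / (s - q) < t" for t
        using that unfolding iff by (simp add: field_simps)
      then have "{t \<in> {0..1}. c < area_ratio p s t} = {t \<in> {0..1}. q + k / (s - q) < t}"
        by blast
      moreover have "1 - (q + k / (s - q)) = p - k / (s - q)" by (simp add: q_def)
      ultimately show ?thesis using False by (simp only: emeasure_upper_part f_def if_False)
    qed
  qed
  have "(\<integral>\<^sup>+s. emeasure lborel {t \<in> {0..1}. c < area_ratio p s t} * indicator {0..1} s \<partial>lborel)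
      = (\<integral>\<^sup>+s. ennreal (f s) * indicator {0..1} s \<partial>lborel)"
    using AE_lborel_singleton[of q] by (intro nn_integral_cong_AE, eventually_elim) (simp only: sec not_False_eq_True)
  also have "\<dots> = ennreal (J + I)"
    by (rule nn_integral_has_integral_lebesgue'[OF f0 int])
  finally show "(\<integral>\<^sup>+s. emeasure lborel {t \<in> {0..1}. c < area_ratio p s t} * indicator {0..1} s \<partial>lborel)
      = ennreal (cut_tail_term c p + cut_tail_term c (1 - p))"
    using IJ by (simp add: add.commute)
qed

lemma nn_integral_unif:
  assumes "f \<in> borel_measurable borel"
  shows "(\<integral>\<^sup>+x. f x \<partial>unif) = (\<integral>\<^sup>+x. f x * indicator {0..1} x \<partial>lborel)"
  using assms by (subst nn_integral_uniform_measure) (auto simp: divide_ennreal_def)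

lemma prob_space_unif: "prob_space unif"
  by (rule prob_space_uniform_measure) auto

lemma nn_integral_unif_triple:
  fixes F :: "real \<times> real \<times> real \<Rightarrow> ennreal"
  assumes F[measurable]: "F \<in> borel_measurable (borel \<Otimes>\<^sub>M borel \<Otimes>\<^sub>M borel)"
  shows "(\<integral>\<^sup>+\<omega>. F (\<omega> 0, \<omega> 1, \<omega> 2) \<partial>(\<Pi>\<^sub>M i\<in>{..<3::nat}. unif))
      = (\<integral>\<^sup>+x. \<integral>\<^sup>+y. \<integral>\<^sup>+z. F (x, y, z) \<partial>unif \<partial>unif \<partial>unif)"
proof -
  interpret U: prob_space unif by (rule prob_space_unif)
  interpret P: product_sigma_finite "\<lambda>_::nat. unif"
    by unfold_locales
  have [measurable_cong]: "sets unif = sets borel" by simp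
  have I: "{..<3::nat} = insert 2 (insert 1 {0})" by auto
  have "(\<integral>\<^sup>+\<omega>. F (\<omega> 0, \<omega> 1, \<omega> 2) \<partial>(\<Pi>\<^sub>M i\<in>{..<3::nat}. unif))
     = (\<integral>\<^sup>+\<omega>. \<integral>\<^sup>+z. F (\<omega> 0, \<omega> 1, z) \<partial>unif \<partial>(\<Pi>\<^sub>M i\<in>insert 1 {0::nat}. unif))"
    unfolding I by (subst P.product_nn_integral_insert) auto
  also have "\<dots> = (\<integral>\<^sup>+\<omega>. \<integral>\<^sup>+y. \<integral>\<^sup>+z. F (\<omega> 0, y, z) \<partial>unif \<partial>unif \<partial>(\<Pi>\<^sub>M i\<in>{0::nat}. unif))"
    by (subst P.product_nn_integral_insert) auto
  also have "\<dots> = (\<integral>\<^sup>+x. \<integral>\<^sup>+y. \<integral>\<^sup>+z. F (x, y, z) \<partial>unif \<partial>unif \<partial>unif)"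
    by (subst P.product_nn_integral_singleton) auto
  finally show ?thesis .
qed

lemma has_integral_cut_tail_term:
  assumes c: "0 < c" "c \<le> 1" and E: "(tail_term c has_integral E) {c..1}"
  shows "((\<lambda>p. cut_tail_term c p + cut_tail_term c (1 - p)) has_integral 2 * E) {0..1}"
proof -
  have "(cut_tail_term c has_integral 0) {0..c}"
    by (rule has_integral_eq[of _ "\<lambda>_. 0"]) (auto simp: cut_tail_term_def)
  moreover have "(cut_tail_term c has_integral E) {c..1}"
    by (rule has_integral_spike_finite[of "{c}" _ _ "tail_term c", OF _ _ E]) (auto simp: cut_tail_term_def)
  ultimately have t: "(cut_tail_term c has_integral (0 + E)) {0..1}"
    by (intro has_integral_combine[of 0 c 1]) (use c in auto)
  then have "((\<lambda>x. cut_tail_term c (- x)) has_integral E) {-1..-0}"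
    by (subst has_integral_reflect_real) simp
  then have "((\<lambda>p. cut_tail_term c (- (p + - 1))) has_integral E) {-1 - - 1..-0 - - 1}"
    by (rule has_integral_shift_real_ivl)
  then have "((\<lambda>p. cut_tail_term c (1 - p)) has_integral E) {0..1}"
    by simp
  from has_integral_add[OF t this] show ?thesis by simp
qed

lemma borel_measurable_area_ratio [measurable (raw)]:
  assumes [measurable]: "f \<in> borel_measurable N" "g \<in> borel_measurable N" "h \<in> borel_measurable N"
  shows "(\<lambda>x. area_ratio (f x) (g x) (h x)) \<in> borel_measurable N"
  unfolding area_ratio_def by measurable

text \<open>
  The section formula holds for \<open>0 < p < 1\<close>, hence the passage to the open interval.
\<close>

lemma nn_integral_area_ratio_gt:
  assumes c: "0 < c" "c \<le> 1" and E: "(tail_term c has_integral E) {c..1}"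
  shows "(\<integral>\<^sup>+x. \<integral>\<^sup>+y. \<integral>\<^sup>+z. indicator {c<..} (area_ratio x y z) \<partial>unif \<partial>unif \<partial>unif) = ennreal (2 * E)"
    and "0 \<le> 2 * E"
proof -
  interpret U: prob_space unif by (rule prob_space_unif)
  have [measurable_cong]: "sets unif = sets borel" by simp
  have m: "(\<lambda>z. area_ratio x y z) \<in> borel_measurable borel" for x y
    unfolding area_ratio_def by measurable
  have inner: "(\<integral>\<^sup>+z. indicator {c<..} (area_ratio x y z) \<partial>unif)
      = emeasure lborel {t \<in> {0..1}. c < area_ratio x y t}" for x y
  proof -
    note m[measurable]
    have "(\<integral>\<^sup>+z. indicator {c<..} (area_ratio x y z) \<partial>unif)
       = (\<integral>\<^sup>+z. indicator {c<..} (area_ratio x y z) * indicator {0..1} z \<partial>lborel)"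
      by (rule nn_integral_unif) measurable
    also have "\<dots> = (\<integral>\<^sup>+z. indicator {t \<in> {0..1}. c < area_ratio x y t} z \<partial>lborel)"
      by (rule nn_integral_cong) (auto simp: indicator_def)
    also have "\<dots> = emeasure lborel {t \<in> {0..1}. c < area_ratio x y t}"
      by (rule nn_integral_indicator) measurable
    finally show ?thesis .
  qed
  have meas: "(\<lambda>(x, y). \<integral>\<^sup>+z. indicator {c<..} (area_ratio x y z) \<partial>unif) \<in> borel_measurable (borel \<Otimes>\<^sub>M borel)"
    by measurable
  have meas1: "(\<lambda>x. \<integral>\<^sup>+y. \<integral>\<^sup>+z. indicator {c<..} (area_ratio x y z) \<partial>unif \<partial>unif) \<in> borel_measurable borel"
    using meas by measurable
  have meas2: "(\<lambda>y. \<integral>\<^sup>+z. indicator {c<..} (area_ratio x y z) \<partial>unif) \<in> borel_measurable borel" for x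
    using meas by measurable
  have middle: "(\<integral>\<^sup>+y. \<integral>\<^sup>+z. indicator {c<..} (area_ratio x y z) \<partial>unif \<partial>unif)
      = ennreal (cut_tail_term c x + cut_tail_term c (1 - x))" if "0 < x" "x < 1" for x
    using section_area(1)[OF that c(1)] by (subst nn_integral_unif[OF meas2]) (simp only: inner)
  have int: "((\<lambda>p. cut_tail_term c p + cut_tail_term c (1 - p)) has_integral 2 * E) {0<..<1}"
    using has_integral_cut_tail_term[OF assms] by (simp add: has_integral_Icc_iff_Ioo)
  have nonneg: "0 \<le> cut_tail_term c x + cut_tail_term c (1 - x)" if "x \<in> {0<..<1}" for x
    using section_area(2)[OF _ _ c(1)] that by auto
  have "(\<integral>\<^sup>+x. \<integral>\<^sup>+y. \<integral>\<^sup>+z. indicator {c<..} (area_ratio x y z) \<partial>unif \<partial>unif \<partial>unif)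
     = (\<integral>\<^sup>+x. (\<integral>\<^sup>+y. \<integral>\<^sup>+z. indicator {c<..} (area_ratio x y z) \<partial>unif \<partial>unif) * indicator {0..1} x \<partial>lborel)"
    by (rule nn_integral_unif[OF meas1])
  also have "\<dots> = (\<integral>\<^sup>+x. ennreal (cut_tail_term c x + cut_tail_term c (1 - x)) * indicator {0<..<1} x \<partial>lborel)"
    using AE_lborel_singleton[of "0::real"] AE_lborel_singleton[of "1::real"]
    by (intro nn_integral_cong_AE, eventually_elim) (auto simp: middle split: split_indicator)
  also have "\<dots> = ennreal (2 * E)"
    by (rule nn_integral_has_integral_lebesgue'[OF nonneg int])
  finally show "(\<integral>\<^sup>+x. \<integral>\<^sup>+y. \<integral>\<^sup>+z. indicator {c<..} (area_ratio x y z) \<partial>unif \<partial>unif \<partial>unif) = ennreal (2 * E)" .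
  show "0 \<le> 2 * E"
    using has_integral_nonneg[OF int nonneg] by simp
qed

lemma (in prob_space) cdf_area_ratio:
  fixes r s t :: "'a \<Rightarrow> real"
  assumes indep: "indep_vars (\<lambda>_. borel) (\<lambda>i. [r, s, t] ! i) {..<3}"
    and unif: "distr M borel r = unif" "distr M borel s = unif" "distr M borel t = unif"
    and c: "0 < c" "c \<le> 1" and E: "(tail_term c has_integral E) {c..1}"
  shows "cdf (distr M borel (\<lambda>\<omega>. area_ratio (r \<omega>) (s \<omega>) (t \<omega>))) c = 1 - 2 * E"
proof -
  have rv: "random_variable borel ([r, s, t] ! i)" if "i < 3" for i
    using indep that by (auto simp: indep_vars_def)
  have [measurable]: "random_variable borel r" "random_variable borel s" "random_variable borel t"
    using rv[of 0] rv[of 1] rv[of 2] by auto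
  let ?X = "\<lambda>\<omega>. \<lambda>i\<in>{..<3}. ([r, s, t] ! i) \<omega>"
  have X: "?X \<in> M \<rightarrow>\<^sub>M (\<Pi>\<^sub>M i\<in>{..<3::nat}. borel)"
    using rv by (intro measurable_restrict) auto
  have "distr M (\<Pi>\<^sub>M i\<in>{..<3::nat}. borel) ?X = (\<Pi>\<^sub>M i\<in>{..<3}. distr M borel ([r, s, t] ! i))"
    using indep_vars_iff_distr_eq_PiM'[where I = "{..<3}" and M' = "\<lambda>_. borel"
        and X = "\<lambda>i. [r, s, t] ! i"] indep rv
    by (auto simp: lessThan_empty_iff)
  also have "\<dots> = (\<Pi>\<^sub>M i\<in>{..<3}. unif)"
  proof (rule PiM_cong[OF refl])
    fix i :: nat assume "i \<in> {..<3}"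
    then have "i = 0 \<or> i = 1 \<or> i = 2" by auto
    then show "distr M borel ([r, s, t] ! i) = unif" using unif by auto
  qed
  finally have joint: "distr M (\<Pi>\<^sub>M i\<in>{..<3::nat}. borel) ?X = (\<Pi>\<^sub>M i\<in>{..<3}. unif)" .
  let ?Q = "\<lambda>\<omega>. area_ratio (r \<omega>) (s \<omega>) (t \<omega>)"
  have Q[measurable]: "random_variable borel ?Q" by measurable
  have "emeasure M {\<omega> \<in> space M. c < ?Q \<omega>} = (\<integral>\<^sup>+\<omega>. indicator {\<omega> \<in> space M. c < ?Q \<omega>} \<omega> \<partial>M)"
    by (rule nn_integral_indicator[symmetric]) measurable
  also have "\<dots> = (\<integral>\<^sup>+\<omega>. indicator {c<..} (area_ratio (?X \<omega> 0) (?X \<omega> 1) (?X \<omega> 2)) \<partial>M)"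
    by (rule nn_integral_cong) (auto simp: indicator_def)
  also have "\<dots> = (\<integral>\<^sup>+\<omega>. indicator {c<..} (area_ratio (\<omega> 0) (\<omega> 1) (\<omega> 2))
      \<partial>distr M (\<Pi>\<^sub>M i\<in>{..<3::nat}. borel) ?X)"
    by (rule nn_integral_distr[OF X, symmetric]) measurable
  also have "\<dots> = ennreal (2 * E)"
    unfolding joint
    using nn_integral_unif_triple[of "\<lambda>(x, y, z). indicator {c<..} (area_ratio x y z)"]
      nn_integral_area_ratio_gt(1)[OF c E] by simp
  finally have "prob {\<omega> \<in> space M. c < ?Q \<omega>} = 2 * E"
    using nn_integral_area_ratio_gt(2)[OF c E] by (simp add: measure_def)
  moreover have "{\<omega> \<in> space M. ?Q \<omega> \<le> c} = space M - {\<omega> \<in> space M. c < ?Q \<omega>}" by auto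
  moreover have "cdf (distr M borel ?Q) c = prob {\<omega> \<in> space M. ?Q \<omega> \<le> c}"
    unfolding cdf_def by (subst measure_distr) (auto simp: vimage_def Int_def conj_commute)
  ultimately show ?thesis
    by (simp add: prob_compl)
qed

lemma signed_area_expand:
  "signed_area X Y Z = ((Y$1 - X$1) * (Z$2 - X$2) - (Y$2 - X$2) * (Z$1 - X$1)) / 2"
  by (simp add: signed_area_def det_2)

lemma signed_area_nonzero:
  assumes "\<not> collinear {A, B, C}"
  shows "signed_area A B C \<noteq> 0"
proof
  assume "signed_area A B C = 0"
  then have eq: "(B$1 - A$1) * (C$2 - A$2) = (B$2 - A$2) * (C$1 - A$1)"
    by (simp add: signed_area_expand)
  have "collinear {0, B - A, C - A}"
  proof (cases "B - A = 0")
    case False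
    then have "(B - A)$1 \<noteq> 0 \<or> (B - A)$2 \<noteq> 0"
      by (auto simp: vec_eq_iff forall_2)
    then have "\<exists>u. C - A = u *\<^sub>R (B - A)"
    proof
      assume "(B - A)$1 \<noteq> 0"
      then show ?thesis using eq
        by (intro exI[of _ "(C - A)$1 / (B - A)$1"]) (auto simp: vec_eq_iff forall_2 eq_divide_eq mult.commute)
    next
      assume "(B - A)$2 \<noteq> 0"
      then show ?thesis using eq
        by (intro exI[of _ "(C - A)$2 / (B - A)$2"]) (auto simp: vec_eq_iff forall_2 eq_divide_eq mult.commute)
    qed
    then show ?thesis by (simp add: collinear_lemma)
  qed (simp add: collinear_lemma)
  then have "collinear {B, A, C}" by (subst collinear_3) (simp_all add: NO_MATCH_def)
  with assms show False by (simp add: insert_commute)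
qed

lemma signed_area_ratio:
  fixes A B C :: "real^2"
  assumes "signed_area A B C \<noteq> 0"
  shows "signed_area (B + r *\<^sub>R (C - B)) (C + s *\<^sub>R (A - C)) (A + t *\<^sub>R (B - A)) / signed_area A B C
    = area_ratio r s t"
proof -
  have "signed_area (B + r *\<^sub>R (C - B)) (C + s *\<^sub>R (A - C)) (A + t *\<^sub>R (B - A))
    = area_ratio r s t * signed_area A B C"
    by (simp add: signed_area_expand area_ratio_def field_simps)
  then show ?thesis using assms by simp
qed

theorem mainTheorem3:
  fixes M :: "'a measure"
    and A B C :: "real^2"
    and r s t Q :: "'a \<Rightarrow> real"
    and R S T :: "'a \<Rightarrow> real^2"
    and CDF :: "real \<Rightarrow> real"
  assumes nondegenerate: "\<not> collinear {A, B, C}"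
    and prob: "prob_space M"
    and indep: "prob_space.indep_vars M (\<lambda>_. borel) (\<lambda>i. [r, s, t] ! i) {..<3}"
    and unif_r: "distr M borel r = uniform_measure lborel {0..1}"
    and unif_s: "distr M borel s = uniform_measure lborel {0..1}"
    and unif_t: "distr M borel t = uniform_measure lborel {0..1}"
  defines "R \<equiv> \<lambda>\<omega>. B + r \<omega> *\<^sub>R (C - B)"
    and "S \<equiv> \<lambda>\<omega>. C + s \<omega> *\<^sub>R (A - C)"
    and "T \<equiv> \<lambda>\<omega>. A + t \<omega> *\<^sub>R (B - A)"
  defines "Q \<equiv> \<lambda>\<omega>. signed_area (R \<omega>) (S \<omega>) (T \<omega>) / signed_area A B C"
  defines "CDF \<equiv> cdf (distr M borel Q)"
  shows "((\<lambda>c. c - (3 * c - 1/2) * ln c + (1 - 4 * c) powr (3/2) * artanh (sqrt (1 - 4 * c)))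
            \<longlongrightarrow> CDF 0) (at_right 0)
    \<and> (\<forall>c. 0 < c \<and> c < 1/4 \<longrightarrow>
          CDF c = c - (3 * c - 1/2) * ln c + (1 - 4 * c) powr (3/2) * artanh (sqrt (1 - 4 * c)))
    \<and> CDF (1/4) = 1/4 * (1 + ln 4)
    \<and> (\<forall>c. 1/4 < c \<and> c \<le> 1 \<longrightarrow>
          CDF c = c - (3 * c - 1/2) * ln c
                  + (4 * c - 1) powr (3/2) * (arctan (sqrt (4 * c - 1)) - pi / 3))"
proof -
  interpret prob_space M by (rule prob)
  have nz: "signed_area A B C \<noteq> 0" by (rule signed_area_nonzero[OF nondegenerate])
  have Q: "Q = (\<lambda>\<omega>. area_ratio (r \<omega>) (s \<omega>) (t \<omega>))"
    unfolding Q_def R_def S_def T_def by (simp add: signed_area_ratio[OF nz])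
  have cdf: "CDF c = 1 - 2 * E" if "0 < c" "c \<le> 1" "(tail_term c has_integral E) {c..1}" for c E
    unfolding CDF_def Q by (rule cdf_area_ratio[OF indep unif_r unif_s unif_t that])
  have cdf': "CDF c = F" if "0 < c" "c \<le> 1" "(tail_term c has_integral (1 - F) / 2) {c..1}" for c F
    using cdf[OF that] by (simp add: field_simps)
  have small: "CDF c = c - (3 * c - 1/2) * ln c + (1 - 4 * c) powr (3/2) * artanh (sqrt (1 - 4 * c))"
    if "0 < c" "c \<le> 1/4" for c
    using that by (intro cdf' has_integral_tail_term_real_roots) auto
  have large: "CDF c = c - (3 * c - 1/2) * ln c
      + (4 * c - 1) powr (3/2) * (arctan (sqrt (4 * c - 1)) - pi / 3)"
    if "1/4 < c" "c \<le> 1" for c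
    using that by (intro cdf' has_integral_tail_term_complex_roots) auto
  have quarter: "CDF (1/4) = 1/4 * (1 + ln 4)"
    by (simp add: small ln_div)
  \<comment> \<open>Measurability makes \<open>CDF\<close> the distribution function of a probability measure on the line,
    which supplies the right-continuity used at \<open>0\<close>.\<close>
  have Q_meas: "random_variable borel Q"
  proof -
    have "random_variable borel ([r, s, t] ! i)" if "i < 3" for i
      using indep that by (auto simp: indep_vars_def)
    from this[of 0] this[of 1] this[of 2] show ?thesis unfolding Q by simp
  qed
  interpret D: real_distribution "distr M borel Q"
    by (rule real_distribution_distr[OF Q_meas])
  have "(CDF \<longlongrightarrow> CDF 0) (at_right 0)"
    using D.cdf_is_right_cont[of 0] unfolding CDF_def continuous_within .
  moreover have "\<forall>\<^sub>F c in at_right 0. CDF c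
      = c - (3 * c - 1/2) * ln c + (1 - 4 * c) powr (3/2) * artanh (sqrt (1 - 4 * c))"
    using eventually_at_right_less[of 0] eventually_at_right_real[of 0 "1/4"]
    by (auto elim!: eventually_mono intro!: small)
  ultimately have "((\<lambda>c. c - (3 * c - 1/2) * ln c
      + (1 - 4 * c) powr (3/2) * artanh (sqrt (1 - 4 * c))) \<longlongrightarrow> CDF 0) (at_right 0)"
    by (rule Lim_transform_eventually)
  then show ?thesis using small large quarter by auto
qed

end
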